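(* Let $(X, \delta\colon X \rightarrow (\mathcal{P}_{\omega} X)^A)$ be an LTS. Then for all $x\in X$, $w\in A^*$, and $\mathcal{I} \in \{\mathcal{R}, \mathcal{F}\}$, $[\![ \{x\} ]\!](w) = \varphi^{\mathcal{I}}_{x}(w)$.
   Context: An LTS is a pair $(X,\delta\colon X\to(\mathcal{P}_\omega X)^A)$ ($\mathcal{P}_\omega$ = finite powerset); write $x\xrightarrow{a}y$ iff $y\in\delta(x)(a)$, extended to words $w\in A^*$ in the usual way ($x\xrightarrow{\varepsilon}y$ iff $y=x$). For $\varphi\colon A\to\mathcal{P}_\omega X$, $I(\varphi)=\{a\in A\mid \varphi(a)\neq\emptyset\}$ and $Fail(\varphi)=\{Z\subseteq A\mid Z\cap I(\varphi)=\emptyset\}$. The LTS is decorated with an output $\overline{o}_{\mathcal{I}}\colon X\to B=\mathcal{P}_\omega(\mathcal{P}_\omega A)$, where $\overline{o}_{\mathcal{R}}(x)=\{I(\delta(x))\}$ (ready) and $\overline{o}_{\mathcal{F}}(x)=Fail(\delta(x))$ (failure). It is determinised into a Moore automaton $(\mathcal{P}_\omega X,\langle o,t\rangle)$ with $o(Y)=\bigcup_{y\in Y}\overline{o}_{\mathcal{I}}(y)$ and $t(Y)(a)=\bigcup_{y\in Y}\delta(y)(a)$; $[\![-]\!]\colon \mathcal{P}_\omega X\to B^{A^*}$ is the unique map into the final Moore coalgebra, given by $[\![Y]\!](\varepsilon)=o(Y)$ and $[\![Y]\!](aw)=[\![t(Y)(a)]\!](w)$. Finally $\varphi^{\mathcal{R}}_{x}(w)=\{I(\delta(y))\mid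 x\xrightarrow{w}y\}$ and $\varphi^{\mathcal{F}}_x(w)=\{Z\subseteq A\mid \exists y.\ x\xrightarrow{w}y \land Z\in Fail(\delta(y))\}$ (these functions encode the sets of ready pairs, resp. failure pairs, of $x$). *)

theory Defs
  imports Main "HOL-Library.FSet"
begin

text \<open>
  States form a type \<open>'x\<close> and actions a type \<open>'a\<close>; an LTS is a map \<open>\<delta> :: 'x \<Rightarrow> 'a \<Rightarrow> 'x fset\<close>.
  The output set \<open>'a fset fset\<close> can contain the ready set \<open>I(\<delta>(x))\<close> and the family of all failure
  sets \<open>Fail(\<delta>(x))\<close> of every state only if there are finitely many actions; hence the class
  constraint \<open>'a::finite\<close>, which discharges the side conditions of the lifted definitions below.
\<close>

type_synonym ('x, 'a) lts = "'x \<Rightarrow> 'a \<Rightarrow> 'x fset"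

primrec steps :: "('x, 'a) lts \<Rightarrow> 'x \<Rightarrow> 'a list \<Rightarrow> 'x \<Rightarrow> bool" where
  "steps \<delta> x [] y \<longleftrightarrow> y = x"
| "steps \<delta> x (a # w) y \<longleftrightarrow> (\<exists>z. z |\<in>| \<delta> x a \<and> steps \<delta> z w y)"

context includes fset.lifting
begin

lift_definition initials :: "('a::finite \<Rightarrow> 'x fset) \<Rightarrow> 'a fset"
  is "\<lambda>\<phi>. {a. \<phi> a \<noteq> {||}}"
  by simp

lift_definition Fail :: "('a::finite \<Rightarrow> 'x fset) \<Rightarrow> 'a fset fset"
  is "\<lambda>\<phi>. {Z. Z |\<inter>| initials \<phi> = {||}}"
  by simp

end

datatype decoration = Ready | Failure

fun decor :: "decoration \<Rightarrow> ('x, 'a::finite) lts \<Rightarrow> 'x \<Rightarrow> 'a fset fset" where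
  "decor Ready \<delta> x = {|initials (\<delta> x)|}"
| "decor Failure \<delta> x = Fail (\<delta> x)"

definition det_out :: "decoration \<Rightarrow> ('x, 'a::finite) lts \<Rightarrow> 'x fset \<Rightarrow> 'a fset fset" where
  "det_out \<I> \<delta> Y = ffUnion (decor \<I> \<delta> |`| Y)"

definition det_trans :: "('x, 'a) lts \<Rightarrow> 'x fset \<Rightarrow> 'a \<Rightarrow> 'x fset" where
  "det_trans \<delta> Y a = ffUnion ((\<lambda>y. \<delta> y a) |`| Y)"

primrec moore_beh :: "('s \<Rightarrow> 'b) \<Rightarrow> ('s \<Rightarrow> 'a \<Rightarrow> 's) \<Rightarrow> 's \<Rightarrow> 'a list \<Rightarrow> 'b" where
  "moore_beh out tr s [] = out s"
| "moore_beh out tr s (a # w) = moore_beh out tr (tr s a) w"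

definition moore_hom ::
  "('s \<Rightarrow> 'b) \<Rightarrow> ('s \<Rightarrow> 'a \<Rightarrow> 's) \<Rightarrow> ('r \<Rightarrow> 'b) \<Rightarrow> ('r \<Rightarrow> 'a \<Rightarrow> 'r) \<Rightarrow> ('s \<Rightarrow> 'r) \<Rightarrow> bool" where
  "moore_hom out tr out' tr' h \<longleftrightarrow>
     (\<forall>s. out' (h s) = out s) \<and> (\<forall>s a. tr' (h s) a = h (tr s a))"

definition lang_out :: "('a list \<Rightarrow> 'b) \<Rightarrow> 'b" where
  "lang_out \<sigma> = \<sigma> []"

definition lang_trans :: "('a list \<Rightarrow> 'b) \<Rightarrow> 'a \<Rightarrow> ('a list \<Rightarrow> 'b)" where
  "lang_trans \<sigma> a = (\<lambda>w. \<sigma> (a # w))"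

text \<open>\<open>moore_beh\<close> is the unique homomorphism into the final Moore coalgebra.\<close>

lemma moore_hom_lang_iff:
  "moore_hom out tr lang_out lang_trans h \<longleftrightarrow> h = moore_beh out tr"
proof
  assume hom: "moore_hom out tr lang_out lang_trans h"
  have "h s w = moore_beh out tr s w" for s w
  proof (induction w arbitrary: s)
    case Nil
    then show ?case using hom by (simp add: moore_hom_def lang_out_def)
  next
    case (Cons a w)
    have "h s (a # w) = h (tr s a) w"
      using hom by (metis moore_hom_def lang_trans_def)
    then show ?case using Cons.IH by simp
  qed
  then show "h = moore_beh out tr" by blast
next
  assume "h = moore_beh out tr"
  then show "moore_hom out tr lang_out lang_trans h"
    by (simp add: moore_hom_def lang_out_def lang_trans_def)
qed

definition det_sem :: "decoration \<Rightarrow> ('x, 'a::finite) lts \<Rightarrow> 'x fset \<Rightarrow> 'a list \<Rightarrow> 'a fset fset" where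
  "det_sem \<I> \<delta> = moore_beh (det_out \<I> \<delta>) (det_trans \<delta>)"

context includes fset.lifting
begin

lift_definition ready_fun :: "('x, 'a::finite) lts \<Rightarrow> 'x \<Rightarrow> 'a list \<Rightarrow> 'a fset fset"
  is "\<lambda>\<delta> x w. {initials (\<delta> y) | y. steps \<delta> x w y}"
  by simp

lift_definition failure_fun :: "('x, 'a::finite) lts \<Rightarrow> 'x \<Rightarrow> 'a list \<Rightarrow> 'a fset fset"
  is "\<lambda>\<delta> x w. {Z. \<exists>y. steps \<delta> x w y \<and> Z |\<in>| Fail (\<delta> y)}"
  by simp

end

fun decor_fun :: "decoration \<Rightarrow> ('x, 'a::finite) lts \<Rightarrow> 'x \<Rightarrow> 'a list \<Rightarrow> 'a fset fset" where
  "decor_fun Ready = ready_fun"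
| "decor_fun Failure = failure_fun"

end

theory Submission imports Defs begin

text \<open>Reading \<open>w\<close> from \<open>{|x|}\<close> in the determinised automaton
  collects exactly the \<open>w\<close>-successors of \<open>x\<close>, and the output there is the
  union of their decorations. So on both sides \<open>Z\<close> is a member iff it lies in the
  decoration of some \<open>w\<close>-successor (\<open>fmember_det_sem_iff\<close>,
  \<open>fmember_decor_fun_iff\<close>).\<close>

lemma fmember_ffUnion_fimage_iff: "Z |\<in>| ffUnion (f |`| Y) \<longleftrightarrow> (\<exists>y. y |\<in>| Y \<and> Z |\<in>| f y)"
  by (auto simp: ffUnion.rep_eq)

text \<open>Arbitrary \<open>Y\<close> is needed for the induction, since a transition can lead from
  a singleton to any finite set.\<close>

lemma fmember_det_sem_iff:
  "Z |\<in>| det_sem \<I> \<delta> Y w \<longleftrightarrow> (\<exists>x y. x |\<in>| Y \<and> steps \<delta> x w y \<and> Z |\<in>| decor \<I> \<delta> y)"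
proof (induction w arbitrary: Y)
  case Nil
  show ?case
    by (simp add: det_sem_def det_out_def fmember_ffUnion_fimage_iff)
next
  case (Cons a w)
  have "det_sem \<I> \<delta> Y (a # w) = det_sem \<I> \<delta> (det_trans \<delta> Y a) w"
    by (simp add: det_sem_def)
  then show ?case
    \<comment> \<open>The hypothesis is used at \<open>det_trans \<delta> Y a\<close>, whose members
      are the first states of the paths after \<open>a\<close>.\<close>
    by (auto simp: Cons.IH det_trans_def fmember_ffUnion_fimage_iff)
qed

text \<open>The only place where the two decorations are told apart; for \<open>Ready\<close>,
  membership in a singleton is equality.\<close>

lemma fmember_decor_fun_iff:
  "Z |\<in>| decor_fun \<I> \<delta> x w \<longleftrightarrow> (\<exists>y. steps \<delta> x w y \<and> Z |\<in>| decor \<I> \<delta> y)"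
  by (cases \<I>) (auto simp: ready_fun.rep_eq failure_fun.rep_eq)

theorem theorem4p1:
  fixes \<delta> :: "('x, 'a::finite) lts"
  shows "\<forall>x w \<I>. det_sem \<I> \<delta> {|x|} w = decor_fun \<I> \<delta> x w"
  by (simp add: fset_eq_iff fmember_det_sem_iff fmember_decor_fun_iff)

end
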